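(* Let $a>0$, $D>0$ be real numbers and $d\ge 2$ an integer. Then every $f\in K(d,D)$ satisfies $$|f(ai)| \ge (2a)^{d/2}\, d^{-d/(2d-2)}\, D^{1/(2d-2)}. \qquad ( * )$$ If, in addition, $$a \le 2^{-1+2/d}\, d^{-1/(d-1)}\, D^{1/(d(d-1))},$$ then, for $f\in K(d,D)$, equality in $( * )$ is attained if and only if $f(x)=F(x)$ or $f(x)=(-1)^dF(-x)$, where $$F(x)=F_{a,B}(x):=\frac{1}{2ad}\Big((ad-Bi)(x+ai)^d+(ad+Bi)(x-ai)^d\Big)$$ with $$B=B(a,d,D):=(-1)^d\, ad\,\sqrt{a^{-d}\,2^{2-d}\,d^{-d/(d-1)}\,D^{1/(d-1)}-1}.$$ Moreover, in this case the roots of $F_{a,B}$ are $$\{x_1,\dots,x_d\}=\{a\tan(\gamma+k\pi/d):\ k=0,1,\dots,d-1\},$$ where $\gamma=\gamma(a,d,D)\in[0,\pi/(2d)]$ is given by $\gamma=\frac{1}{d}\arccos p(a,d,D)$ if $d$ is odd and $\gamma=\frac1d\arcsin p(a,d,D)$ if $d$ is even, with $$p(a,d,D):=a^{d/2}\,2^{d/2-1}\,d^{d/(2d-2)}\,D^{-1/(2d-2)}\le 1.$$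
   Context: For a monic polynomial $f(x)=\prod_{k=1}^d(x-x_k)$ the discriminant is $\Delta_f=\prod_{1\le j<k\le d}(x_j-x_k)^2$. For an integer $d\ge2$ and real $D>0$, $K(d,D)$ denotes the set of monic polynomials of degree $d$ in $\mathbb{R}[x]$ all of whose $d$ roots (counted with multiplicity) are real and whose discriminant equals $D$. Here $i=\sqrt{-1}$. *)

theory Defs
  imports
    "HOL-Analysis.Analysis"
    "HOL-Computational_Algebra.Computational_Algebra"
    "HOL-Combinatorics.Permutations"
begin

(* Only meaningful for monic polynomials that split into linear factors (over the complex numbers:
   for all monic polynomials). The result does not depend on the enumeration x of the roots, see
   discriminant_eqI. *)
definition discriminant :: "'a :: idom poly \<Rightarrow> 'a" where
  "discriminant f = (THE D. \<exists>x :: nat \<Rightarrow> 'a.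
     f = (\<Prod>k<degree f. [:- x k, 1:]) \<and>
     D = (\<Prod>(j, k) | j < k \<and> k < degree f. (x j - x k)\<^sup>2))"

definition K :: "nat \<Rightarrow> real \<Rightarrow> real poly set" where
  "K d D = {f. lead_coeff f = 1 \<and> degree f = d \<and>
      (\<forall>z :: complex. poly (map_poly complex_of_real f) z = 0 \<longrightarrow> z \<in> \<real>) \<and>
      discriminant (map_poly complex_of_real f) = complex_of_real D}"

definition lower_bound :: "real \<Rightarrow> nat \<Rightarrow> real \<Rightarrow> real" where
  "lower_bound a d D =
     (2 * a) powr (real d / 2) * real d powr (- real d / (2 * real d - 2))
       * D powr (1 / (2 * real d - 2))"

definition B_coeff :: "real \<Rightarrow> nat \<Rightarrow> real \<Rightarrow> real" where
  "B_coeff a d D = (- 1) ^ d * a * real d *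
     sqrt (a powr (- real d) * 2 powr (2 - real d) * real d powr (- real d / (real d - 1))
             * D powr (1 / (real d - 1)) - 1)"

definition F_poly :: "real \<Rightarrow> nat \<Rightarrow> real \<Rightarrow> complex poly" where
  "F_poly a d B = smult (1 / (2 * of_real a * of_nat d))
     (smult (of_real a * of_nat d - of_real B * \<i>) ([:of_real a * \<i>, 1:] ^ d)
      + smult (of_real a * of_nat d + of_real B * \<i>) ([:- (of_real a * \<i>), 1:] ^ d))"

definition F_reflected :: "real \<Rightarrow> nat \<Rightarrow> real \<Rightarrow> complex poly" where
  "F_reflected a d B = smult ((- 1) ^ d) (pcompose (F_poly a d B) [:0, - 1:])"

definition p_param :: "real \<Rightarrow> nat \<Rightarrow> real \<Rightarrow> real" where
  "p_param a d D = a powr (real d / 2) * 2 powr (real d / 2 - 1)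
     * real d powr (real d / (2 * real d - 2)) * D powr (- 1 / (2 * real d - 2))"

definition gamma_angle :: "real \<Rightarrow> nat \<Rightarrow> real \<Rightarrow> real" where
  "gamma_angle a d D =
     (if odd d then arccos (p_param a d D) / real d else arcsin (p_param a d D) / real d)"


lemma prod_linear_factors:
  fixes x :: "nat \<Rightarrow> 'a :: idom"
  shows "degree (\<Prod>k<d. [:- x k, 1:]) = d"
    and "lead_coeff (\<Prod>k<d. [:- x k, 1:]) = 1"
    and "proots (\<Prod>k<d. [:- x k, 1:]) = mset (map x [0..<d])"
proof -
  show "degree (\<Prod>k<d. [:- x k, 1:]) = d"
    by (subst degree_prod_eq_sum_degree) auto
  show "lead_coeff (\<Prod>k<d. [:- x k, 1:]) = 1"
    by (simp add: lead_coeff_prod)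
  show "proots (\<Prod>k<d. [:- x k, 1:]) = mset (map x [0..<d])"
  proof (induction d)
    case (Suc d)
    have "proots ((\<Prod>k<d. [:- x k, 1:]) * [:- x d, 1:])
        = proots (\<Prod>k<d. [:- x k, 1:]) + proots [:- x d, 1:]"
      by (rule proots_mult) auto
    with Suc show ?case by (simp del: mult_pCons_right)
  qed auto
qed

lemma prod_pairs_permute:
  fixes x :: "nat \<Rightarrow> 'a :: idom"
  assumes p: "p permutes {..<d}"
  shows "(\<Prod>(j, k) | j < k \<and> k < d. (x (p j) - x (p k))\<^sup>2)
       = (\<Prod>(j, k) | j < k \<and> k < d. (x j - x k)\<^sup>2)"
proof -
  define h where "h q = (\<lambda>(j, k). if q j < q k then (q j, q k) else (q k, q j :: nat))"
    for q :: "nat \<Rightarrow> nat"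
  have inv: "h q' (h q u) = u \<and> h q u \<in> {(j, k). j < k \<and> k < d}"
    if q: "q permutes {..<d}" and q': "\<And>n. q' (q n) = n" and u: "u \<in> {(j, k). j < k \<and> k < d}"
    for q q' u
  proof -
    obtain j k where [simp]: "u = (j, k)" by (cases u)
    from u have jk: "j < k" "k < d" by auto
    have "q j < d" "q k < d"
      using permutes_in_image[OF q, of j] permutes_in_image[OF q, of k] jk by auto
    moreover have "q j \<noteq> q k" using q'[of j] q'[of k] jk by auto
    ultimately show ?thesis using jk by (auto simp: h_def q')
  qed
  show ?thesis
  proof (rule prod.reindex_bij_witness[where i = "h (inv_into UNIV p)" and j = "h p"])
    fix u assume "u \<in> {(j, k). j < k \<and> k < d}"
    from inv[OF p permutes_inverses(2)[OF p] this]
    show "h (inv_into UNIV p) (h p u) = u" "h p u \<in> {(j, k). j < k \<and> k < d}" by auto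
  next
    fix u assume "u \<in> {(j, k). j < k \<and> k < d}"
    from inv[OF permutes_inv[OF p] permutes_inverses(1)[OF p] this]
    show "h p (h (inv_into UNIV p) u) = u" "h (inv_into UNIV p) u \<in> {(j, k). j < k \<and> k < d}"
      by auto
  next
    fix u :: "nat \<times> nat"
    show "(case h p u of (j, k) \<Rightarrow> (x j - x k)\<^sup>2) = (case u of (j, k) \<Rightarrow> (x (p j) - x (p k))\<^sup>2)"
      by (cases u) (auto simp: h_def power2_commute)
  qed
qed

lemma discriminant_eqI:
  fixes x :: "nat \<Rightarrow> 'a :: idom"
  assumes f: "f = (\<Prod>k<d. [:- x k, 1:])"
  shows "discriminant f = (\<Prod>(j, k) | j < k \<and> k < d. (x j - x k)\<^sup>2)"
proof -
  have deg: "degree f = d" unfolding f by (rule prod_linear_factors)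
  show ?thesis unfolding discriminant_def deg
  proof (rule the_equality)
    fix D assume "\<exists>y. f = (\<Prod>k<d. [:- y k, 1:]) \<and>
        D = (\<Prod>(j, k) | j < k \<and> k < d. (y j - y k)\<^sup>2)"
    then obtain y where y: "f = (\<Prod>k<d. [:- y k, 1:])"
      "D = (\<Prod>(j, k) | j < k \<and> k < d. (y j - y k)\<^sup>2)" by blast
    have "mset (map y [0..<d]) = mset (map x [0..<d])"
      using f y(1) prod_linear_factors(3)[of x d] prod_linear_factors(3)[of y d] by simp
    then obtain p where p: "p permutes {..<d}" "permute_list p (map x [0..<d]) = map y [0..<d]"
      using mset_eq_permutation[of "map y [0..<d]" "map x [0..<d]"] by auto
    have yx: "y n = x (p n)" if "n < d" for n
    proof -
      have "map y [0..<d] ! n = map x [0..<d] ! p n"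
        unfolding p(2)[symmetric] using p(1) that by (subst permute_list_nth) auto
      moreover have "p n < d" using permutes_in_image[OF p(1), of n] that by auto
      ultimately show ?thesis using that by simp
    qed
    have "D = (\<Prod>(j, k) | j < k \<and> k < d. (x (p j) - x (p k))\<^sup>2)"
      unfolding y(2) by (intro prod.cong) (auto simp: yx)
    also have "\<dots> = (\<Prod>(j, k) | j < k \<and> k < d. (x j - x k)\<^sup>2)"
      by (rule prod_pairs_permute[OF p(1)])
    finally show "D = (\<Prod>(j, k) | j < k \<and> k < d. (x j - x k)\<^sup>2)" .
  qed (use f in blast)
qed

lemma map_poly_of_real_prod:
  fixes x :: "nat \<Rightarrow> real"
  shows "map_poly complex_of_real (\<Prod>k<d. [:- x k, 1:]) = (\<Prod>k<d. [:- complex_of_real (x k), 1:])"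
proof (induction d)
  case (Suc d)
  have hom: "map_poly complex_of_real (p * q)
      = map_poly complex_of_real p * map_poly complex_of_real q" for p q
    by (intro poly_eqI) (simp add: coeff_map_poly coeff_mult)
  from Suc show ?case by (simp add: hom map_poly_pCons del: mult_pCons_right mult_pCons_left)
qed (simp add: map_poly_1)

lemma in_K_iff:
  "f \<in> K d D \<longleftrightarrow> (\<exists>x :: nat \<Rightarrow> real. f = (\<Prod>k<d. [:- x k, 1:]) \<and>
     (\<Prod>(j, k) | j < k \<and> k < d. (x j - x k)\<^sup>2) = D)"
proof -
  let ?c = "map_poly complex_of_real"
  have disc: "discriminant (?c f) = complex_of_real (\<Prod>(j, k) | j < k \<and> k < d. (x j - x k)\<^sup>2)"
    if "f = (\<Prod>k<d. [:- x k, 1:])" for x :: "nat \<Rightarrow> real"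
  proof -
    have "?c f = (\<Prod>k<d. [:- complex_of_real (x k), 1:])"
      unfolding that by (rule map_poly_of_real_prod)
    from discriminant_eqI[OF this] show ?thesis
      by (simp add: case_prod_unfold)
  qed
  show ?thesis
  proof
    assume f: "f \<in> K d D"
    have deg: "degree (?c f) = d" using f by (simp add: K_def degree_map_poly)
    have lc: "lead_coeff (?c f) = 1" using f by (auto simp: K_def degree_map_poly coeff_map_poly)
    then have "?c f \<noteq> 0" by auto
    from alg_closed_imp_factorization[OF this] obtain A where
      A: "size A = d" "?c f = (\<Prod>z\<in>#A. [:- z, 1:])" using deg lc by auto
    obtain zs where zs: "mset zs = A" using ex_mset by blast
    have len: "length zs = d" using A(1) zs by auto
    have eq: "?c f = (\<Prod>k<d. [:- (zs ! k), 1:])"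
    proof -
      have "?c f = prod_list (map (\<lambda>z. [:- z, 1:]) zs)"
        unfolding A(2) zs[symmetric] by (simp flip: prod_mset_prod_list)
      then show ?thesis by (simp add: prod.list_conv_set_nth len atLeast0LessThan)
    qed
    have real: "zs ! k \<in> \<real>" if "k < d" for k
    proof -
      have "poly (?c f) (zs ! k) = 0" unfolding eq poly_prod using that by (auto simp: prod_zero_iff)
      with f show ?thesis by (simp add: K_def)
    qed
    define x where "x k = Re (zs ! k)" for k
    have "?c f = (\<Prod>k<d. [:- complex_of_real (x k), 1:])"
      unfolding eq by (intro prod.cong) (use real in \<open>auto simp: x_def\<close>)
    also have "\<dots> = ?c (\<Prod>k<d. [:- x k, 1:])" by (rule map_poly_of_real_prod[symmetric])
    finally have "?c f = ?c (\<Prod>k<d. [:- x k, 1:])" .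
    then have fx: "f = (\<Prod>k<d. [:- x k, 1:])"
      by (simp add: poly_eq_iff coeff_map_poly)
    from f disc[OF fx] have "(\<Prod>(j, k) | j < k \<and> k < d. (x j - x k)\<^sup>2) = D"
      unfolding K_def by (simp del: of_real_prod)
    with fx show "\<exists>x :: nat \<Rightarrow> real. f = (\<Prod>k<d. [:- x k, 1:]) \<and>
        (\<Prod>(j, k) | j < k \<and> k < d. (x j - x k)\<^sup>2) = D" by blast
  next
    assume "\<exists>x :: nat \<Rightarrow> real. f = (\<Prod>k<d. [:- x k, 1:]) \<and>
        (\<Prod>(j, k) | j < k \<and> k < d. (x j - x k)\<^sup>2) = D"
    then obtain x :: "nat \<Rightarrow> real" where x: "f = (\<Prod>k<d. [:- x k, 1:])"
      "(\<Prod>(j, k) | j < k \<and> k < d. (x j - x k)\<^sup>2) = D" by blast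
    have "z \<in> \<real>" if "poly (?c f) z = 0" for z
      using that unfolding x(1) map_poly_of_real_prod poly_prod by (auto simp: prod_zero_iff)
    moreover have "lead_coeff f = 1" "degree f = d"
      unfolding x(1) by (rule prod_linear_factors)+
    ultimately show "f \<in> K d D" unfolding K_def using disc[OF x(1)] x(2) by simp
  qed
qed

end

theory Submission
  imports Defs
begin

text \<open>
  Write the roots as \<open>x\<^sub>k = a tan \<alpha>\<^sub>k\<close>. Then \<open>x\<^sub>j - x\<^sub>k = a sin (\<alpha>\<^sub>j - \<alpha>\<^sub>k) / (cos \<alpha>\<^sub>j cos \<alpha>\<^sub>k)\<close> and
  \<open>|ai - x\<^sub>k| = a / |cos \<alpha>\<^sub>k|\<close>, so \<open>D a\<^bsup>d(d-1)\<^esup> = |f(ai)|\<^bsup>2(d-1)\<^esup> S\<close>, where \<open>S\<close> is the product of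
  \<open>|sin (\<alpha>\<^sub>j - \<alpha>\<^sub>k)|\<close> over all ordered pairs. Order the angles and continue them by \<open>\<alpha>\<^bsub>k+d\<^esub> = \<alpha>\<^sub>k + \<pi>\<close>.
  For each shift \<open>m\<close> the differences \<open>\<alpha>\<^bsub>k+m\<^esub> - \<alpha>\<^sub>k\<close> add up to \<open>m\<pi>\<close>, so by concavity of \<open>ln sin\<close> the
  product \<open>S\<close> is largest exactly for equidistant angles, where it equals \<open>(d / 2\<^bsup>d-1\<^esup>)\<^bsup>d\<^esup>\<close>. Polynomials
  with equidistant angles are of the form \<open>F\<^bsub>a,b\<^esub>\<close>, and \<open>|F\<^bsub>a,b\<^esub>(ai)|\<close> determines \<open>b\<close> up to sign.
\<close>

section \<open>Polynomials with known simple roots and the product of sin (m pi / d)\<close>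

text \<open>The difference \<open>h\<close> of the two sides has degree at most \<open>d\<close> and
  its coefficient at \<open>d\<close> cancels. It also has \<open>d\<close> distinct roots, so if
  nonzero it would have degree exactly \<open>d\<close>.\<close>

lemma poly_eq_smult_prod_roots:
  fixes f :: "'a :: idom poly"
  assumes deg: "degree f \<le> d" and inj: "inj_on x {..<d}"
    and roots: "\<And>k. k < d \<Longrightarrow> poly f (x k) = 0"
  shows "f = smult (coeff f d) (\<Prod>k<d. [:- x k, 1:])"
proof (rule ccontr)
  define g where "g = (\<Prod>k<d. [:- x k, 1:])"
  define h where "h = f - smult (coeff f d) g"
  assume "f \<noteq> smult (coeff f d) (\<Prod>k<d. [:- x k, 1:])"
  then have h0: "h \<noteq> 0" by (simp add: h_def g_def)
  have g: "degree g = d" "lead_coeff g = 1"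
    unfolding g_def by (rule prod_linear_factors)+
  have "degree h \<le> d"
    unfolding h_def using deg g(1) by (intro degree_diff_le) (auto intro: order_trans[OF degree_smult_le])
  moreover have "d \<le> degree h"
  proof -
    have "x ` {..<d} \<subseteq> {z. poly h z = 0}"
      using roots by (auto simp: h_def g_def poly_prod prod_zero_iff)
    then have "card (x ` {..<d}) \<le> card {z. poly h z = 0}"
      using h0 poly_roots_finite by (intro card_mono) auto
    also have "\<dots> \<le> degree h" using h0 by (rule card_poly_roots_bound)
    finally show ?thesis using inj by (simp add: card_image)
  qed
  ultimately have "lead_coeff h = coeff h d" by simp
  also have "\<dots> = 0" using g by (simp add: h_def)
  finally show False using h0 by simp
qed

lemma norm_one_minus_cis: "cmod (1 - cis t) = 2 * \<bar>sin (t / 2)\<bar>"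
proof -
  have c: "cos t = 1 - 2 * (sin (t/2))\<^sup>2" using cos_double_sin[of "t/2"] by simp
  have "(cmod (1 - cis t))\<^sup>2 = 2 - 2 * cos t"
    using sin_cos_squared_add[of t] unfolding cmod_power2
    by (simp add: power2_eq_square algebra_simps)
  also have "\<dots> = (2 * \<bar>sin (t / 2)\<bar>)\<^sup>2" by (simp add: c power_mult_distrib)
  finally show ?thesis by (rule power2_eq_imp_eq) auto
qed

lemma sin_pi_frac_pos:
  assumes "0 < m" "m < d" shows "sin (real m * pi / real d) > 0"
proof (rule sin_gt_zero)
  show "real m * pi / real d < pi" using assms by (simp add: field_simps)
qed (use assms in auto)

text \<open>The polynomial 1 + w + ... + w^(d-1) is the product of the w - z over the d-th roots of
  unity z other than 1. At w = 1 this gives d, and each factor has modulus 2 sin (m pi / d), the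
  length of a chord.\<close>

lemma prod_sin_pi_frac:
  assumes d: "d \<ge> 1"
  shows "(\<Prod>m\<in>{1..<d}. sin (real m * pi / real d)) = real d / 2 ^ (d - 1)"
proof -
  \<comment> \<open>\<open>Suc k\<close> skips the root 1. The factor 2 is kept in front because
    \<open>norm_one_minus_cis\<close> halves the angle.\<close>
  define z where "z k = cis (2 * (real (Suc k) * pi / real d))" for k
  define f where "f = (\<Sum>j<d. monom (1 :: complex) j)"
  have z1: "z k \<noteq> 1" if "k < d - 1" for k
  proof -
    have "cmod (1 - z k) > 0"
    proof -
      have "0 < Suc k" "Suc k < d" using that by auto
      from sin_pi_frac_pos[OF this] show ?thesis
        unfolding z_def norm_one_minus_cis by simp
    qed
    then show ?thesis by auto
  qed
  have zz: "z k \<noteq> z l" if "k < l" "l < d - 1" for k l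
  proof
    assume eq: "z k = z l"
    have "z l = z k * cis (2 * (real (l - k) * pi / real d))"
    proof -
      have "2 * (real (Suc l) * pi / real d)
          = 2 * (real (Suc k) * pi / real d) + 2 * (real (l - k) * pi / real d)"
        using that by (simp add: of_nat_diff algebra_simps flip: add_divide_distrib)
      then show ?thesis unfolding z_def cis_mult by simp
    qed
    then have "cis (2 * (real (l - k) * pi / real d)) = 1" using eq by (simp add: z_def)
    then have "cmod (1 - cis (2 * (real (l - k) * pi / real d))) = 0" by simp
    moreover have "0 < l - k" "l - k < d" using that by auto
    ultimately show False
      unfolding norm_one_minus_cis using sin_pi_frac_pos[of "l - k" d] by simp
  qed
  have zd: "z k ^ d = 1" for k
  proof -
    have "real d * (2 * (real (Suc k) * pi / real d)) = 2 * pi * real (Suc k)"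
      using d by simp
    then have "z k ^ d = cis (2 * pi * real (Suc k))"
      unfolding z_def Complex.DeMoivre by (rule arg_cong)
    also have "\<dots> = 1" by (rule cis_multiple_2pi) auto
    finally show ?thesis .
  qed
  have pf: "poly f w = (\<Sum>j<d. w ^ j)" for w
    by (simp add: f_def poly_sum poly_monom)
  have cf: "coeff f (d - 1) = 1"
    using d by (simp add: f_def coeff_sum)
  have "f = smult (coeff f (d - 1)) (\<Prod>k<d - 1. [:- z k, 1:])"
  proof (rule poly_eq_smult_prod_roots)
    show "degree f \<le> d - 1" unfolding f_def
      by (intro degree_sum_le) (auto simp: degree_monom_eq)
    show "inj_on z {..<d - 1}"
      by (rule linorder_inj_onI) (use zz in auto)
    show "poly f (z k) = 0" if "k < d - 1" for k
      unfolding pf using z1[OF that] zd[of k] geometric_sum[of "z k" d] by simp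
  qed
  from arg_cong[OF this, of "\<lambda>f. poly f 1"] have "of_nat d = (\<Prod>k<d - 1. 1 - z k)"
    unfolding cf by (simp add: pf poly_prod)
  from arg_cong[OF this, of cmod] have "real d = (\<Prod>k<d - 1. cmod (1 - z k))"
    by (simp add: prod_norm)
  also have "\<dots> = (\<Prod>k<d - 1. 2 * sin (real (Suc k) * pi / real d))"
    unfolding z_def norm_one_minus_cis
  proof (intro prod.cong refl)
    fix k assume "k \<in> {..<d - 1}"
    then have "sin (real (Suc k) * pi / real d) > 0" by (intro sin_pi_frac_pos) auto
    then show "2 * \<bar>sin (2 * (real (Suc k) * pi / real d) / 2)\<bar> = 2 * sin (real (Suc k) * pi / real d)"
      by simp
  qed
  also have "\<dots> = 2 ^ (d - 1) * (\<Prod>k<d - 1. sin (real (Suc k) * pi / real d))"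
    by (simp add: prod.distrib)
  also have "(\<Prod>k<d - 1. sin (real (Suc k) * pi / real d)) = (\<Prod>m\<in>{1..<d}. sin (real m * pi / real d))"
    by (rule prod.reindex_bij_witness[where i = "\<lambda>m. m - 1" and j = Suc]) auto
  finally show ?thesis by (simp add: field_simps)
qed

section \<open>Concavity of ln sin on (0, pi)\<close>

text \<open>The right-hand side is the tangent of ln sin at \<open>c\<close>. Subtracting its slope
  leaves \<open>g\<close> with derivative cot t - cot c, positive before \<open>c\<close> and
  negative after it, so \<open>g\<close> has a strict maximum at \<open>c\<close>.\<close>

lemma sin_tangent_bound:
  fixes c x :: real
  assumes c: "0 < c" "c < pi" and x: "0 < x" "x < pi"
  shows "ln (sin x) \<le> ln (sin c) + cot c * (x - c)"
    and "ln (sin x) = ln (sin c) + cot c * (x - c) \<Longrightarrow> x = c"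
proof -
  define g where "g t = ln (sin t) - cot c * t" for t
  have der: "(g has_real_derivative cot t - cot c) (at t)" if "0 < t" "t < pi" for t
    unfolding g_def using sin_gt_zero[OF that] sin_gt_zero[OF c]
    by (auto intro!: derivative_eq_intros simp: cot_def field_simps)
  have cot: "cot t - cot s = sin (s - t) / (sin s * sin t)" if "0 < t" "t < pi" "0 < s" "s < pi" for s t :: real
    using sin_gt_zero[OF that(1,2)] sin_gt_zero[OF that(3,4)]
    by (simp add: cot_def sin_diff field_simps)
  have strict: "g x < g c" if "x \<noteq> c"
  proof (cases "x < c")
    case True
    show ?thesis
    proof (rule DERIV_pos_imp_increasing_open[OF True])
      fix t assume t: "x < t" "t < c"
      have "cot t - cot c > 0"
        using t c x by (subst cot) (auto intro!: divide_pos_pos mult_pos_pos sin_gt_zero)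
      then show "\<exists>y. (g has_real_derivative y) (at t) \<and> 0 < y"
        using der[of t] t c x by auto
    next
      show "continuous_on {x..c} g"
        by (rule DERIV_continuous_on[OF has_field_derivative_at_within[OF der]])
           (use c x in auto)
    qed
  next
    case False
    with that have xc: "c < x" by simp
    show ?thesis
    proof (rule DERIV_neg_imp_decreasing_open[OF xc])
      fix t assume t: "c < t" "t < x"
      have "cot c - cot t > 0"
        using t c x by (subst cot) (auto intro!: divide_pos_pos mult_pos_pos sin_gt_zero)
      then show "\<exists>y. (g has_real_derivative y) (at t) \<and> y < 0"
        using der[of t] t c x by (intro exI[of _ "cot t - cot c"]) auto
    next
      show "continuous_on {c..x} g"
        by (rule DERIV_continuous_on[OF has_field_derivative_at_within[OF der]])
           (use c x in auto)
    qed
  qed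
  show "ln (sin x) \<le> ln (sin c) + cot c * (x - c)"
    using strict by (cases "x = c") (auto simp: g_def algebra_simps)
  show "x = c" if "ln (sin x) = ln (sin c) + cot c * (x - c)"
    using strict that by (cases "x = c") (auto simp: g_def algebra_simps)
qed

text \<open>Jensen's inequality with its equality case, obtained by summing the tangent bounds at
  the mean \<open>c\<close> of the \<open>y i\<close>.\<close>

lemma prod_sin_le:
  fixes y :: "'a \<Rightarrow> real"
  assumes I: "finite I" and y: "\<And>i. i \<in> I \<Longrightarrow> 0 < y i \<and> y i < pi"
    and c: "0 < c" "c < pi" and s: "(\<Sum>i\<in>I. y i) = real (card I) * c"
  shows "(\<Prod>i\<in>I. sin (y i)) \<le> sin c ^ card I"
    and "(\<Prod>i\<in>I. sin (y i)) = sin c ^ card I \<Longrightarrow> i \<in> I \<Longrightarrow> y i = c"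
proof -
  let ?t = "\<lambda>i. ln (sin c) + cot c * (y i - c)"
  have pos: "sin (y i) > 0" if "i \<in> I" for i using y[OF that] by (auto intro: sin_gt_zero)
  have c0: "sin c > 0" using c by (rule sin_gt_zero)
  have L: "ln (\<Prod>i\<in>I. sin (y i)) = (\<Sum>i\<in>I. ln (sin (y i)))"
    using I less_imp_neq[OF pos] by (intro ln_prod) auto
  \<comment> \<open>The linear terms cancel because \<open>c\<close> is the mean.\<close>
  have T: "(\<Sum>i\<in>I. ?t i) = ln (sin c ^ card I)"
    using s c0 by (simp add: sum.distrib sum_subtractf ln_realpow flip: sum_distrib_left)
  have le: "(\<Sum>i\<in>I. ln (sin (y i))) \<le> (\<Sum>i\<in>I. ?t i)"
    using y c by (intro sum_mono sin_tangent_bound) auto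
  have P: "(\<Prod>i\<in>I. sin (y i)) > 0" using pos by (intro prod_pos) auto
  show "(\<Prod>i\<in>I. sin (y i)) \<le> sin c ^ card I"
    using le P c0 unfolding T L[symmetric] by simp
  show "y i = c" if eq: "(\<Prod>i\<in>I. sin (y i)) = sin c ^ card I" and i: "i \<in> I"
  proof -
    have "(\<Sum>i\<in>I. ?t i - ln (sin (y i))) = 0"
      using L T eq by (simp add: sum_subtractf)
    moreover have "\<And>i. i \<in> I \<Longrightarrow> ?t i - ln (sin (y i)) \<ge> 0"
      using sin_tangent_bound(1)[OF c] y by auto
    ultimately have "?t i - ln (sin (y i)) = 0"
      using I i by (metis (no_types, lifting) sum_nonneg_eq_0_iff)
    then show ?thesis using sin_tangent_bound(2)[OF c] y[OF i] by auto
  qed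
qed

section \<open>Products of sines of angle differences\<close>

text \<open>Each square is split over the two orders of its pair. This form has one row for each
  index \<open>i\<close>, and rows can be rearranged cyclically. In the induction the new index
  \<open>d\<close> contributes one row and one column.\<close>

lemma prod_pairs_eq_prod_ordered_pairs:
  fixes x :: "nat \<Rightarrow> real"
  shows "(\<Prod>(j, k) | j < k \<and> k < d. (x j - x k)\<^sup>2) = (\<Prod>i<d. \<Prod>k\<in>{..<d} - {i}. \<bar>x i - x k\<bar>)"
proof (induction d)
  case (Suc d)
  have fin: "finite {(j, k). j < k \<and> k < d}"
    by (rule finite_subset[of _ "{..<d} \<times> {..<d}"]) auto
  have "{(j, k). j < k \<and> k < Suc d} = {(j, k). j < k \<and> k < d} \<union> (\<lambda>j. (j, d)) ` {..<d}"
    by auto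
  then have "(\<Prod>(j, k) | j < k \<and> k < Suc d. (x j - x k)\<^sup>2)
      = (\<Prod>(j, k) | j < k \<and> k < d. (x j - x k)\<^sup>2) * (\<Prod>(j, k)\<in>(\<lambda>j. (j, d)) ` {..<d}. (x j - x k)\<^sup>2)"
    using fin by (auto intro!: prod.union_disjoint)
  also have "(\<Prod>(j, k)\<in>(\<lambda>j. (j, d)) ` {..<d}. (x j - x k)\<^sup>2) = (\<Prod>j<d. (x j - x d)\<^sup>2)"
    by (subst prod.reindex) (auto intro: inj_onI)
  also have "\<dots> = (\<Prod>j<d. \<bar>x j - x d\<bar>) * (\<Prod>k<d. \<bar>x d - x k\<bar>)"
    by (simp add: power2_eq_square abs_minus_commute abs_mult_self_eq flip: prod.distrib)
  finally have L: "(\<Prod>(j, k) | j < k \<and> k < Suc d. (x j - x k)\<^sup>2)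
      = (\<Prod>i<d. \<Prod>k\<in>{..<d} - {i}. \<bar>x i - x k\<bar>) * ((\<Prod>j<d. \<bar>x j - x d\<bar>) * (\<Prod>k<d. \<bar>x d - x k\<bar>))"
    unfolding Suc .
  have "{..<Suc d} - {i} = insert d ({..<d} - {i})" if "i < d" for i
    using that by auto
  then have "(\<Prod>i<d. \<Prod>k\<in>{..<Suc d} - {i}. \<bar>x i - x k\<bar>)
      = (\<Prod>i<d. \<bar>x i - x d\<bar> * (\<Prod>k\<in>{..<d} - {i}. \<bar>x i - x k\<bar>))"
    by (intro prod.cong) auto
  moreover have "{..<Suc d} - {d} = {..<d}" by auto
  ultimately show ?case unfolding L by (simp add: prod.distrib)
qed auto

text \<open>Shifting an angle by pi only changes the sign of the sine, so the factors have period
  \<open>d\<close> in \<open>k\<close>. The residues other than \<open>i\<close> may therefore be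
  taken from the window i+1, ..., i+d-1.\<close>

lemma prod_sin_diff_cyclic:
  fixes A :: "nat \<Rightarrow> real"
  assumes A: "\<And>n. A (n + d) = A n + pi" and i: "i < d"
  shows "(\<Prod>k\<in>{..<d} - {i}. \<bar>sin (A i - A k)\<bar>) = (\<Prod>m\<in>{1..<d}. \<bar>sin (A (i + m) - A i)\<bar>)"
proof -
  define h where "h n = \<bar>sin (A i - A n)\<bar>" for n
  have per: "h (n + d) = h n" for n
  proof -
    have "A i - A (n + d) = (A i - A n) - pi" by (simp only: A diff_diff_eq)
    then show ?thesis unfolding h_def by (simp only: sin_minus_pi abs_minus_cancel)
  qed
  have "(\<Prod>m\<in>{1..<d}. \<bar>sin (A (i + m) - A i)\<bar>) = (\<Prod>m\<in>{1..<d}. h (m + i))"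
  proof (intro prod.cong refl)
    fix m show "\<bar>sin (A (i + m) - A i)\<bar> = h (m + i)"
      using sin_minus[of "A (i + m) - A i"] by (simp add: h_def add.commute)
  qed
  also have "\<dots> = prod h {1 + i..<d + i}"
    by (rule prod.shift_bounds_nat_ivl[symmetric])
  \<comment> \<open>The window is cut at \<open>d\<close>; by periodicity the second piece wraps
    around to the indices below \<open>i\<close>.\<close>
  also have "\<dots> = prod h {1 + i..<d} * prod h {0 + d..<i + d}"
    using i prod.atLeastLessThan_concat[of "1 + i" d "d + i" h] by (simp add: add.commute)
  also have "prod h {0 + d..<i + d} = prod h {0..<i}"
    unfolding prod.shift_bounds_nat_ivl per ..
  also have "prod h {1 + i..<d} * prod h {0..<i} = prod h ({1 + i..<d} \<union> {0..<i})"
    by (rule prod.union_disjoint[symmetric]) auto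
  also have "{1 + i..<d} \<union> {0..<i} = {..<d} - {i}" using i by auto
  finally show ?thesis by (simp add: h_def)
qed

text \<open>The value at the extremal configuration: every row equals the product in
  \<open>prod_sin_pi_frac\<close>.\<close>

lemma prod_sin_diff_arith_progression:
  assumes d: "d \<ge> 1"
  shows "(\<Prod>i<d. \<Prod>k\<in>{..<d} - {i}. \<bar>sin ((\<beta> + real i * pi / real d) - (\<beta> + real k * pi / real d))\<bar>)
    = (real d / 2 ^ (d - 1)) ^ d"
proof -
  define A where "A n = \<beta> + real n * pi / real d" for n
  have per: "A (n + d) = A n + pi" for n using d by (simp add: A_def field_simps)
  have "(\<Prod>i<d. \<Prod>k\<in>{..<d} - {i}. \<bar>sin (A i - A k)\<bar>)
      = (\<Prod>i<d. \<Prod>m\<in>{1..<d}. \<bar>sin (A (i + m) - A i)\<bar>)"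
    by (intro prod.cong refl prod_sin_diff_cyclic per) auto
  also have "\<dots> = (\<Prod>i<d. \<Prod>m\<in>{1..<d}. sin (real m * pi / real d))"
  proof (intro prod.cong refl)
    fix i m assume "m \<in> {1..<d}"
    moreover have "A (i + m) - A i = real m * pi / real d"
      by (simp add: A_def algebra_simps add_divide_distrib)
    ultimately show "\<bar>sin (A (i + m) - A i)\<bar> = sin (real m * pi / real d)"
      using sin_pi_frac_pos[of m d] by simp
  qed
  also have "\<dots> = (real d / 2 ^ (d - 1)) ^ d" by (simp only: prod_sin_pi_frac[OF d]) simp
  finally show ?thesis by (simp only: A_def)
qed

text \<open>The product is regrouped by the shift \<open>m\<close> instead of the index
  \<open>i\<close>. For fixed \<open>m\<close> the differences lie in (0, pi) and have mean m pi /
  d, so \<open>prod_sin_le\<close> applies. In the equality case the shift 1 alone already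
  determines the spacing.\<close>

lemma prod_sin_diff_le:
  fixes A :: "nat \<Rightarrow> real"
  assumes A: "\<And>n. A (n + d) = A n + pi" and mono: "strict_mono A" and d: "d \<ge> 2"
  defines "S \<equiv> (\<Prod>i<d. \<Prod>k\<in>{..<d} - {i}. \<bar>sin (A i - A k)\<bar>)"
  shows "S \<le> (real d / 2 ^ (d - 1)) ^ d"
    and "S = (real d / 2 ^ (d - 1)) ^ d \<Longrightarrow> i < d \<Longrightarrow> A (Suc i) = A i + pi / real d"
proof -
  define y where "y m i = A (i + m) - A i" for m i
  define P where "P m = (\<Prod>i<d. sin (y m i))" for m
  define Q where "Q m = sin (real m * pi / real d) ^ d" for m
  have y: "0 < y m i \<and> y m i < pi" if m: "m \<in> {1..<d}" for m i
  proof -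
    have "A i < A (i + m)" "A (i + m) < A (i + d)"
      using m by (auto intro!: strict_monoD[OF mono])
    then show ?thesis by (simp add: y_def A)
  qed
  have sum_y: "(\<Sum>i<d. y m i) = real (card {..<d}) * (real m * pi / real d)" for m
  proof -
    have "(\<Sum>i<d. y m i) = real m * pi"
    \<comment> \<open>Raising \<open>m\<close> by one adds consecutive differences that telescope
      over one period, to pi.\<close>
    proof (induction m)
      case (Suc m)
      have "(\<Sum>i<d. y (Suc m) i) = (\<Sum>i<d. y m i) + (\<Sum>i<d. A (Suc i + m) - A (i + m))"
        by (simp add: y_def flip: sum.distrib)
      also have "(\<Sum>i<d. A (Suc i + m) - A (i + m)) = pi"
        using sum_lessThan_telescope[of "\<lambda>i. A (i + m)" d] A[of m] by (simp add: add.commute)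
      finally show ?case using Suc by (simp add: algebra_simps)
    qed (simp add: y_def)
    then show ?thesis using d by simp
  qed
  have frac: "0 < real m * pi / real d" "real m * pi / real d < pi" if "m \<in> {1..<d}" for m
    using that by (auto simp: field_simps)
  have P0: "P m > 0" if m: "m \<in> {1..<d}" for m
    unfolding P_def using y[OF m] by (intro prod_pos) (auto intro: sin_gt_zero)
  have PQ: "P m \<le> Q m" if m: "m \<in> {1..<d}" for m
    unfolding P_def Q_def
    using prod_sin_le(1)[of "{..<d}" "y m", OF _ y[OF m] frac[OF m] sum_y] by simp
  have "S = (\<Prod>i<d. \<Prod>m\<in>{1..<d}. sin (y m i))"
    unfolding S_def
  proof (rule prod.cong[OF refl])
    fix i assume "i \<in> {..<d}"
    then have "(\<Prod>k\<in>{..<d} - {i}. \<bar>sin (A i - A k)\<bar>) = (\<Prod>m\<in>{1..<d}. \<bar>sin (y m i)\<bar>)"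
      unfolding y_def by (intro prod_sin_diff_cyclic A) auto
    also have "\<dots> = (\<Prod>m\<in>{1..<d}. sin (y m i))"
      by (intro prod.cong refl abs_of_pos sin_gt_zero) (use y in auto)
    finally show "(\<Prod>k\<in>{..<d} - {i}. \<bar>sin (A i - A k)\<bar>) = \<dots>" .
  qed
  also have "\<dots> = prod P {1..<d}" unfolding P_def by (rule prod.swap)
  finally have S: "S = prod P {1..<d}" .
  have Qd: "(real d / 2 ^ (d - 1)) ^ d = prod Q {1..<d}"
    unfolding Q_def prod_power_distrib[symmetric] using prod_sin_pi_frac[of d] d by simp
  show "S \<le> (real d / 2 ^ (d - 1)) ^ d"
    unfolding S Qd using P0 PQ by (intro prod_mono) (auto intro: less_imp_le)
  show "A (Suc i) = A i + pi / real d" if eq: "S = (real d / 2 ^ (d - 1)) ^ d" and i: "i < d"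
  proof -
    have 1: "1 \<in> {1..<d}" using d by simp
    \<comment> \<open>All factors are positive, so a strict inequality at the shift 1 would make the
      whole product strictly smaller.\<close>
    have "P 1 = Q 1"
    proof (rule ccontr)
      assume "P 1 \<noteq> Q 1"
      with PQ[OF 1] have "P 1 < Q 1" by simp
      with 1 have "prod P {1..<d} < prod Q {1..<d}"
      proof (rule prod_mono_strict)
        show "0 \<le> P m \<and> P m \<le> Q m" "0 < Q m" if "m \<in> {1..<d}" for m
          using P0[OF that] PQ[OF that] by auto
      qed simp
      with eq show False unfolding S Qd by simp
    qed
    then have "y 1 i = real 1 * pi / real d"
      unfolding P_def Q_def
      using prod_sin_le(2)[of "{..<d}" "y 1", OF _ y[OF 1] frac[OF 1] sum_y] i by simp
    then show ?thesis by (simp add: y_def)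
  qed
qed

text \<open>Angles spread over less than pi extend to an increasing sequence \<open>A\<close> with A
  (n + d) = A n + pi, to which \<open>prod_sin_diff_le\<close> applies.\<close>

lemma prod_sin_diff_le_interval:
  fixes \<alpha> :: "nat \<Rightarrow> real"
  assumes mono: "strict_mono_on {..<d} \<alpha>" and len: "\<alpha> (d - 1) < \<alpha> 0 + pi" and d: "d \<ge> 2"
  defines "S \<equiv> (\<Prod>i<d. \<Prod>k\<in>{..<d} - {i}. \<bar>sin (\<alpha> i - \<alpha> k)\<bar>)"
  shows "S \<le> (real d / 2 ^ (d - 1)) ^ d"
    and "S = (real d / 2 ^ (d - 1)) ^ d \<Longrightarrow> i < d \<Longrightarrow> \<alpha> i = \<alpha> 0 + real i * pi / real d"
proof -
  define A where "A n = \<alpha> (n mod d) + pi * real (n div d)" for n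
  have eq: "A i = \<alpha> i" if "i < d" for i using that by (simp add: A_def)
  have per: "A (n + d) = A n + pi" for n using d by (simp add: A_def algebra_simps)
  have sm: "strict_mono A"
  proof (rule strict_monoI_Suc)
    fix n show "A n < A (Suc n)"
    proof (cases "Suc (n mod d) = d")
      \<comment> \<open>The step into the next period is where the hypothesis on the spread is
        used.\<close>
      case True
      then have "n mod d = d - 1" by simp
      with True len d show ?thesis by (simp add: A_def mod_Suc div_Suc algebra_simps)
    next
      case False
      moreover have "n mod d < d" using d by simp
      ultimately have "Suc (n mod d) < d" by linarith
      with False strict_mono_onD[OF mono, of "n mod d" "Suc (n mod d)"]
      show ?thesis by (simp add: A_def mod_Suc div_Suc)
    qed
  qed
  have S: "S = (\<Prod>i<d. \<Prod>k\<in>{..<d} - {i}. \<bar>sin (A i - A k)\<bar>)"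
    unfolding S_def by (intro prod.cong refl) (auto simp: eq)
  show "S \<le> (real d / 2 ^ (d - 1)) ^ d"
    unfolding S by (rule prod_sin_diff_le[OF per sm d])
  show "\<alpha> i = \<alpha> 0 + real i * pi / real d"
    if S_eq: "S = (real d / 2 ^ (d - 1)) ^ d" and i: "i < d"
  proof -
    have step: "A (Suc j) = A j + pi / real d" if "j < d" for j
      using prod_sin_diff_le(2)[OF per sm d] that S_eq unfolding S by blast
    have "A i = A 0 + real i * pi / real d" using i
      by (induction i) (auto simp: step field_simps)
    then show ?thesis using i d by (simp add: eq)
  qed
qed

section \<open>The discriminant in terms of angles\<close>

text \<open>With r k = |ai - x k| = a / |cos (\<alpha> k)|, each ordered pair satisfies a |x i - x
  k| = r i r k |sin (\<alpha> i - \<alpha> k)|. Over all ordered pairs every \<open>r k\<close>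
  occurs 2(d-1) times.\<close>

lemma discriminant_tan_roots:
  fixes \<alpha> :: "nat \<Rightarrow> real"
  assumes a: "a > 0" and c: "\<And>k. k < d \<Longrightarrow> cos (\<alpha> k) \<noteq> 0" and d: "d \<ge> 1"
  defines "x \<equiv> \<lambda>k. a * tan (\<alpha> k)"
  shows "(\<Prod>(j, k) | j < k \<and> k < d. (x j - x k)\<^sup>2) * a ^ (d * (d - 1))
     = (\<Prod>k<d. cmod (of_real a * \<i> - of_real (x k))) ^ (2 * (d - 1))
       * (\<Prod>i<d. \<Prod>k\<in>{..<d} - {i}. \<bar>sin (\<alpha> i - \<alpha> k)\<bar>)"
proof -
  define r where "r k = cmod (of_real a * \<i> - of_real (x k))" for k
  define R where "R = prod r {..<d}"
  have r: "r k = a / \<bar>cos (\<alpha> k)\<bar>" if k: "k < d" for k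
  proof -
    have "(r k)\<^sup>2 = a\<^sup>2 * (1 + (tan (\<alpha> k))\<^sup>2)"
      unfolding r_def cmod_power2 by (simp add: x_def power_mult_distrib algebra_simps)
    also have "\<dots> = (a / \<bar>cos (\<alpha> k)\<bar>)\<^sup>2"
      using tan_sec[OF c[OF k]] by (simp add: power_divide divide_inverse power_mult_distrib power_inverse)
    finally show ?thesis using a by (intro power2_eq_imp_eq[of "r k"]) (auto simp: r_def)
  qed
  have r0: "r k > 0" if "k < d" for k using r[OF that] c[OF that] a by simp
  have diff: "a * \<bar>x i - x k\<bar> = r i * r k * \<bar>sin (\<alpha> i - \<alpha> k)\<bar>" if "i < d" "k < d" for i k
  proof -
    have "x i - x k = a * (sin (\<alpha> i - \<alpha> k) / (cos (\<alpha> i) * cos (\<alpha> k)))"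
      using c[OF that(1)] c[OF that(2)] by (simp add: x_def tan_def sin_diff field_simps)
    then show ?thesis
      using a by (simp add: r that abs_mult)
  qed
  have row: "a ^ (d - 1) * (\<Prod>k\<in>{..<d} - {i}. \<bar>x i - x k\<bar>)
      = r i ^ (d - 2) * R * (\<Prod>k\<in>{..<d} - {i}. \<bar>sin (\<alpha> i - \<alpha> k)\<bar>)" if d2: "d \<ge> 2" and i: "i < d" for i
  proof -
    have "a ^ (d - 1) * (\<Prod>k\<in>{..<d} - {i}. \<bar>x i - x k\<bar>)
        = (\<Prod>k\<in>{..<d} - {i}. a * \<bar>x i - x k\<bar>)"
      using i by (simp add: prod.distrib card_Diff_singleton)
    also have "\<dots> = (\<Prod>k\<in>{..<d} - {i}. r i * r k * \<bar>sin (\<alpha> i - \<alpha> k)\<bar>)"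
      using i by (intro prod.cong refl diff) auto
    also have "\<dots> = r i ^ (d - 1) * prod r ({..<d} - {i}) * (\<Prod>k\<in>{..<d} - {i}. \<bar>sin (\<alpha> i - \<alpha> k)\<bar>)"
      using i by (simp add: prod.distrib card_Diff_singleton)
    \<comment> \<open>One factor \<open>r i\<close> completes the product to \<open>R\<close>. This
      requires \<open>d\<close> at least 2; for d = 1 all pair products are empty.\<close>
    also have "r i ^ (d - 1) * prod r ({..<d} - {i}) = r i ^ (d - 2) * R"
    proof -
      have "R = r i * prod r ({..<d} - {i})"
        unfolding R_def using i by (intro prod.remove) auto
      moreover have "d - 1 = Suc (d - 2)" using d2 by simp
      ultimately show ?thesis by simp
    qed
    finally show ?thesis .
  qed
  show ?thesis
  proof (cases "d = 1")
    case False
    then have d2: "d \<ge> 2" using d by simp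
    have "(\<Prod>(j, k) | j < k \<and> k < d. (x j - x k)\<^sup>2) * a ^ (d * (d - 1))
        = (\<Prod>i<d. a ^ (d - 1) * (\<Prod>k\<in>{..<d} - {i}. \<bar>x i - x k\<bar>))"
      unfolding prod_pairs_eq_prod_ordered_pairs
      by (simp add: prod.distrib power_mult mult.commute flip: power_mult)
    also have "\<dots> = (\<Prod>i<d. r i ^ (d - 2) * R * (\<Prod>k\<in>{..<d} - {i}. \<bar>sin (\<alpha> i - \<alpha> k)\<bar>))"
      by (intro prod.cong refl row d2) auto
    also have "\<dots> = R ^ (d - 2) * R ^ d * (\<Prod>i<d. \<Prod>k\<in>{..<d} - {i}. \<bar>sin (\<alpha> i - \<alpha> k)\<bar>)"
      by (simp add: prod.distrib R_def prod_power_distrib)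
    also have "R ^ (d - 2) * R ^ d = R ^ (2 * (d - 1))"
      using d2 by (simp flip: power_add) (simp add: numeral_2_eq_2)
    finally show ?thesis by (simp add: R_def r_def)
  qed (auto intro!: prod.neutral simp: less_Suc_eq)
qed

section \<open>The family F with parameter b\<close>

text \<open>A combination \<open>G\<close> of (z + ai)^d and (z - ai)^d vanishes at all the given
  roots. Dividing it by its leading coefficient \<open>L\<close> leaves conjugate coefficients with
  sum 1, which is the shape of \<open>F_poly\<close>.\<close>

lemma prod_tan_roots_eq_F_poly:
  fixes a \<beta> :: real
  assumes a: "a > 0" and d: "d \<ge> 1"
    and c: "\<And>k. k < d \<Longrightarrow> cos (\<beta> + real k * pi / real d) \<noteq> 0"
  defines "E \<equiv> cis (real d * \<beta>)" and "L \<equiv> cis (real d * \<beta>) - (- 1) ^ d * cnj (cis (real d * \<beta>))"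
  shows "(\<Prod>k<d. [:- complex_of_real (a * tan (\<beta> + real k * pi / real d)), 1:])
      = F_poly a d (- 2 * a * real d * Im (E / L))"
proof -
  define \<theta> where "\<theta> k = \<beta> + real k * pi / real d" for k
  define x where "x k = complex_of_real (a * tan (\<theta> k))" for k
  \<comment> \<open>Up to a nonzero factor, \<^term>\<open>G\<close> at \<open>a tan t\<close> is \<open>sin (d (\<beta> - t))\<close>.\<close>
  define G where "G = smult E ([:of_real a * \<i>, 1:] ^ d)
     - smult ((- 1) ^ d * cnj E) ([:- (of_real a * \<i>), 1:] ^ d)"
  have pG: "poly G z = E * (z + of_real a * \<i>) ^ d - (- 1) ^ d * cnj E * (z - of_real a * \<i>) ^ d" for z
    by (simp add: G_def algebra_simps)
  have GL: "coeff G d = L"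
    by (simp add: G_def L_def E_def coeff_linear_power)
  have root: "poly G (x k) = 0" if k: "k < d" for k
  proof -
    define w where "w = of_real a * \<i> / of_real (cos (\<theta> k))"
    have cn: "cos (\<theta> k) \<noteq> 0" using c[OF k] by (simp add: \<theta>_def)
    have 1: "x k + of_real a * \<i> = w * cis (- \<theta> k)" "x k - of_real a * \<i> = - (w * cis (\<theta> k))"
      using cn by (auto simp: x_def w_def tan_def complex_eq_iff field_simps)
    have "E * (x k + of_real a * \<i>) ^ d = w ^ d * cis (real d * \<beta> - real d * \<theta> k)"
      unfolding 1 by (simp add: power_mult_distrib Complex.DeMoivre E_def cis_mult mult_ac)
    moreover have "(- 1) ^ d * cnj E * (x k - of_real a * \<i>) ^ d = w ^ d * cis (real d * \<theta> k - real d * \<beta>)"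
      unfolding 1 power_minus[of "w * cis (\<theta> k)"]
      by (simp add: power_mult_distrib Complex.DeMoivre E_def cis_cnj cis_mult mult_ac flip: power_add)
    \<comment> \<open>The two angles above thus become -k pi and k pi, and the two terms of
      \<open>G\<close> agree.\<close>
    moreover have "real d * \<theta> k = real d * \<beta> + pi * real k"
      using d by (simp add: \<theta>_def field_simps)
    moreover have "cis (- (pi * real k)) = cis (pi * real k)"
      using sin_npi2[of k] by (simp add: complex_eq_iff)
    ultimately show ?thesis unfolding pG by simp
  qed
  have "x k \<noteq> x l" if kl: "k < l" "l < d" for k l
  proof
    assume "x k = x l"
    then have "tan (\<theta> k) = tan (\<theta> l)" using a by (simp add: x_def)
    then have "sin (\<theta> l - \<theta> k) = 0"
      using c[of k] c[of l] kl unfolding \<theta>_def[symmetric]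
      by (simp add: tan_def sin_diff field_simps)
    moreover have "\<theta> l - \<theta> k = real (l - k) * pi / real d"
      using kl by (simp add: \<theta>_def of_nat_diff algebra_simps diff_divide_distrib)
    moreover have "0 < l - k" "l - k < d" using kl by auto
    ultimately show False using sin_pi_frac_pos[of "l - k" d] by simp
  qed
  then have inj: "inj_on x {..<d}" by (intro linorder_inj_onI) auto
  have "degree G \<le> d"
    unfolding G_def by (intro degree_diff_le) (auto intro!: order_trans[OF degree_smult_le] simp: degree_linear_power)
  from poly_eq_smult_prod_roots[OF this inj root]
  have G: "G = smult L (\<Prod>k<d. [:- x k, 1:])" by (simp add: GL)
  \<comment> \<open>At ai only the first power survives. If \<open>L\<close> were 0, then
    \<open>G\<close> would be the zero polynomial.\<close>
  have "poly G (of_real a * \<i>) \<noteq> 0"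
    using a d unfolding pG by (simp add: E_def power_0_left)
  then have L: "L \<noteq> 0" unfolding G by auto
  have "cnj L = - ((- 1) ^ d * L)"
    by (simp add: L_def algebra_simps flip: power_add)
  then have cnjq: "- ((- 1) ^ d * cnj E) / L = cnj (E / L)"
    using L by (cases "even d") (auto simp: field_simps)
  have "E / L + cnj (E / L) = 1"
    unfolding cnjq[symmetric] using L by (simp add: E_def L_def flip: diff_divide_distrib)
  from arg_cong[OF this, of Re] have re: "Re (E / L) = 1 / 2"
    by (simp del: complex_cnj_divide)
  \<comment> \<open>The coefficients of \<open>F_poly\<close> are 1/2 -+ i b/(2ad), so
    \<open>b\<close> is read off from the imaginary part of \<open>E / L\<close>.\<close>
  define b where "b = - 2 * a * real d * Im (E / L)"
  have cE: "1 / (2 * of_real a * of_nat d) * (of_real a * of_nat d - of_real b * \<i>) = E / L"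
    proof -
    have "1 / (2 * of_real a * of_nat d) * (of_real a * of_nat d - of_real b * \<i>)
        = complex_of_real (1 / 2) + complex_of_real (- b / (2 * a * real d)) * \<i>"
      using a d by (simp add: field_simps)
    also have "- b / (2 * a * real d) = Im (E / L)" using a d by (simp add: b_def)
    also have "complex_of_real (1 / 2) + complex_of_real (Im (E / L)) * \<i> = E / L"
      unfolding re[symmetric] by (subst complex_eq[of "E / L"]) (simp add: mult.commute)
    finally show ?thesis .
  qed
  have cE': "1 / (2 * of_real a * of_nat d) * (of_real a * of_nat d + of_real b * \<i>) = cnj (E / L)"
    using arg_cong[OF cE, of cnj] by simp
  have "F_poly a d b = smult (E / L) ([:of_real a * \<i>, 1:] ^ d) + smult (cnj (E / L)) ([:- (of_real a * \<i>), 1:] ^ d)"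
    unfolding F_poly_def smult_add_right smult_smult cE cE' ..
  also have "\<dots> = smult (1 / L) G"
    unfolding cnjq[symmetric] G_def by (simp add: smult_diff_right field_simps)
  also have "\<dots> = (\<Prod>k<d. [:- x k, 1:])" using L by (simp add: G)
  finally show "(\<Prod>k<d. [:- complex_of_real (a * tan (\<beta> + real k * pi / real d)), 1:])
      = F_poly a d (- 2 * a * real d * Im (E / L))"
    by (simp add: b_def x_def \<theta>_def)
qed

text \<open>The power of z - ai vanishes at ai. The modulus depends on \<open>b\<close> only through
  its square, hence determines \<open>b\<close> up to sign.\<close>

lemma cmod_F_poly:
  assumes a: "a > 0" and d: "d \<ge> 1"
  shows "cmod (poly (F_poly a d b) (of_real a * \<i>)) = sqrt ((a * real d)\<^sup>2 + b\<^sup>2) * (2 * a) ^ d / (2 * a * real d)"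
proof -
  have "poly (F_poly a d b) (of_real a * \<i>) = 1 / (2 * of_real a * of_nat d) * ((of_real a * of_nat d - of_real b * \<i>) * (2 * of_real a * \<i>) ^ d)"
    using d by (simp add: F_poly_def power_0_left power_mult_distrib mult_ac)
  moreover have "cmod (of_real a * of_nat d - of_real b * \<i>) = sqrt ((a * real d)\<^sup>2 + b\<^sup>2)"
    by (simp add: cmod_def)
  ultimately show ?thesis
    using a by (simp add: norm_mult norm_divide norm_power)
qed

text \<open>Replacing z by -z exchanges the two powers up to (-1)^d, which amounts to exchanging the
  conjugate coefficients.\<close>

lemma F_reflected_eq: "F_reflected a d b = F_poly a d (- b)"
proof -
  have "poly (F_reflected a d b) z = poly (F_poly a d (- b)) z" for z
  proof -
    have 1: "(of_real a * \<i> - z) ^ d = (- 1) ^ d * (z - of_real a * \<i>) ^ d"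
      "(- z - of_real a * \<i>) ^ d = (- 1) ^ d * (z + of_real a * \<i>) ^ d"
      by (simp_all flip: power_mult_distrib)
    have "(- 1 :: complex) ^ d * (- 1) ^ d = 1" by (simp flip: power_mult_distrib)
    then show ?thesis
      using 1 by (simp add: F_reflected_def F_poly_def poly_pcompose algebra_simps)
  qed
  then show ?thesis by (simp add: fun_eq_iff flip: poly_eq_poly_eq_iff)
qed

section \<open>Relations between the bound, p and B\<close>

lemma lower_bound_pos: "a > 0 \<Longrightarrow> D > 0 \<Longrightarrow> d \<ge> 2 \<Longrightarrow> lower_bound a d D > 0"
  by (simp add: lower_bound_def)

lemma p_param_pos: "a > 0 \<Longrightarrow> D > 0 \<Longrightarrow> d \<ge> 2 \<Longrightarrow> p_param a d D > 0"
  by (simp add: p_param_def)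

text \<open>Shaped to match \<open>discriminant_tan_roots\<close>: the bound is the modulus |f(ai)|
  that goes with the maximal sine product.\<close>

lemma lower_bound_power:
  assumes a: "a > 0" and D: "D > 0" and d: "d \<ge> 2"
  shows "D * a ^ (d * (d - 1)) = lower_bound a d D ^ (2 * (d - 1)) * (real d / 2 ^ (d - 1)) ^ d"
proof -
  \<comment> \<open>The power 2(d-1) clears the denominators of all exponents.\<close>
  define n where "n = 2 * (d - 1)"
  have n: "real n = 2 * real d - 2" "n \<noteq> 0" using d by (auto simp: n_def of_nat_diff)
  have pw: "(x powr y) ^ n = x powr (y * real n)" if "x > 0" for x y :: real
    using that by (simp add: powr_powr flip: powr_realpow)
  have "((2 * a) powr (real d / 2)) ^ n = (2 * a) ^ (d * (d - 1))"
  proof -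
    have "real d / 2 * real n = real (d * (d - 1))"
      using d by (simp add: n(1) of_nat_diff algebra_simps)
    then have "((2 * a) powr (real d / 2)) ^ n = (2 * a) powr real (d * (d - 1))"
      using a by (simp only: pw)
    also have "\<dots> = (2 * a) ^ (d * (d - 1))" using a by (intro powr_realpow) auto
    finally show ?thesis .
  qed
  moreover have "(real d powr (- real d / (2 * real d - 2))) ^ n = 1 / real d ^ d"
    using d by (subst pw) (auto simp: n(1) powr_minus_divide powr_realpow)
  moreover have "(D powr (1 / (2 * real d - 2))) ^ n = D"
    using D d by (subst pw) (auto simp: n(1))
  ultimately have "lower_bound a d D ^ n = (2 * a) ^ (d * (d - 1)) * (1 / real d ^ d) * D"
    by (simp add: lower_bound_def power_mult_distrib)
  then show ?thesis
    using d by (simp add: n_def power_divide power_mult_distrib mult.commute flip: power_mult)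
qed

text \<open>The meaning of p: it is the ratio of (2a)^d / 2, the modulus at ai for b = 0, to the
  lower bound.\<close>

lemma lower_bound_times_p_param:
  assumes a: "a > 0" and D: "D > 0" and d: "d \<ge> 2"
  shows "lower_bound a d D * (2 * p_param a d D) = (2 * a) ^ d"
proof -
  have "a powr (real d / 2) * a powr (real d / 2) = a ^ d"
    using a by (simp add: powr_realpow flip: powr_add)
  moreover have "2 powr (real d / 2) * (2 * 2 powr (real d / 2 - 1)) = 2 ^ d"
    by (simp add: powr_diff powr_realpow flip: powr_add)
  moreover have "real d powr (- real d / (2 * real d - 2)) * real d powr (real d / (2 * real d - 2)) = 1"
    using d by (simp flip: powr_add)
  moreover have "D powr (1 / (2 * real d - 2)) * D powr (- 1 / (2 * real d - 2)) = 1"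
    using D by (simp flip: powr_add)
  moreover have "lower_bound a d D * (2 * p_param a d D) =
     (a powr (real d / 2) * a powr (real d / 2)) * (2 powr (real d / 2) * (2 * 2 powr (real d / 2 - 1)))
     * (real d powr (- real d / (2 * real d - 2)) * real d powr (real d / (2 * real d - 2)))
     * (D powr (1 / (2 * real d - 2)) * D powr (- 1 / (2 * real d - 2)))"
    using a unfolding lower_bound_def p_param_def by (simp add: powr_mult mult_ac)
  ultimately show ?thesis by (simp add: power_mult_distrib)
qed

text \<open>Identifies the radicand in \<open>B_coeff\<close> as 1/p^2 - 1.\<close>

lemma inverse_p_param_squared:
  assumes a: "a > 0" and D: "D > 0" and d: "d \<ge> 2"
  shows "a powr (- real d) * 2 powr (2 - real d) * real d powr (- real d / (real d - 1))
     * D powr (1 / (real d - 1)) = 1 / (p_param a d D)\<^sup>2"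
proof -
  have "1 / (p_param a d D)\<^sup>2 = p_param a d D powr (- 2)"
    using p_param_pos[OF assms] by (simp add: powr_minus_divide powr_numeral)
  also have "\<dots> = a powr (real d / 2 * (- 2)) * 2 powr ((real d / 2 - 1) * (- 2))
     * real d powr (real d / (2 * real d - 2) * (- 2)) * D powr (- 1 / (2 * real d - 2) * (- 2))"
    using a D d unfolding p_param_def by (simp add: powr_mult powr_powr)
  also have "real d / 2 * (- 2) = - real d" by simp
  also have "(real d / 2 - 1) * (- 2) = 2 - real d" by simp
  also have "real d / (2 * real d - 2) * (- 2) = - real d / (real d - 1)"
    using d by (simp add: divide_simps)
  also have "- 1 / (2 * real d - 2) * (- 2) = 1 / (real d - 1)"
    using d by (simp add: divide_simps)
  finally show ?thesis ..
qed

text \<open>The d-th power of the hypothesis, divided by a^d, says that 1 is at most 1/p^2.\<close>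

lemma p_param_le_one:
  assumes a: "a > 0" and D: "D > 0" and d: "d \<ge> 2"
    and le: "a \<le> 2 powr (- 1 + 2 / real d) * real d powr (- 1 / (real d - 1))
                * D powr (1 / (real d * (real d - 1)))"
  shows "p_param a d D \<le> 1"
proof -
  have "a powr real d \<le> (2 powr (- 1 + 2 / real d) * real d powr (- 1 / (real d - 1))
                * D powr (1 / (real d * (real d - 1)))) powr real d"
    using a le by (intro powr_mono2) auto
  also have "\<dots> = 2 powr ((- 1 + 2 / real d) * real d) * real d powr (- 1 / (real d - 1) * real d)
                * D powr (1 / (real d * (real d - 1)) * real d)"
    using D d by (simp add: powr_mult powr_powr)
  also have "(- 1 + 2 / real d) * real d = 2 - real d" using d by (simp add: field_simps)
  also have "- 1 / (real d - 1) * real d = - real d / (real d - 1)" by simp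
  also have "1 / (real d * (real d - 1)) * real d = 1 / (real d - 1)" using d by simp
  finally have le: "a powr real d \<le> 2 powr (2 - real d) * real d powr (- real d / (real d - 1))
     * D powr (1 / (real d - 1))" .
  have "1 \<le> a powr (- real d) * X" if "a powr real d \<le> X" for X
    using that a by (simp add: powr_minus_divide)
  from this[OF le] have "1 \<le> a powr (- real d) * (2 powr (2 - real d) * real d powr (- real d / (real d - 1))
     * D powr (1 / (real d - 1)))" .
  also have "\<dots> = 1 / (p_param a d D)\<^sup>2"
    using inverse_p_param_squared[OF a D d] by (simp add: mult.assoc)
  finally have "(p_param a d D)\<^sup>2 \<le> 1\<^sup>2"
    using p_param_pos[OF a D d] by (simp add: divide_simps)
  then show ?thesis using power2_le_imp_le[of "p_param a d D" 1] by simp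
qed

lemma B_coeff_eq:
  assumes a: "a > 0" and D: "D > 0" and d: "d \<ge> 2"
  shows "B_coeff a d D = (- 1) ^ d * a * real d * sqrt (1 - (p_param a d D)\<^sup>2) / p_param a d D"
proof -
  have "1 / (p_param a d D)\<^sup>2 - 1 = (1 - (p_param a d D)\<^sup>2) / (p_param a d D)\<^sup>2"
    using p_param_pos[OF assms] by (simp add: field_simps)
  then show ?thesis
    unfolding B_coeff_def inverse_p_param_squared[OF assms]
    using p_param_pos[OF assms] by (simp add: real_sqrt_divide)
qed

text \<open>Dividing the modulus by the bound gives sqrt ((ad)^2 + b^2) p / (ad). Setting this to 1
  and squaring yields b^2 = (ad)^2 (1 - p^2) / p^2, which is B^2.\<close>

lemma cmod_F_poly_eq_lower_bound_iff:
  assumes a: "a > 0" and D: "D > 0" and d: "d \<ge> 2" and p: "p_param a d D \<le> 1"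
  shows "cmod (poly (F_poly a d b) (of_real a * \<i>)) = lower_bound a d D
    \<longleftrightarrow> b = B_coeff a d D \<or> b = - B_coeff a d D"
proof -
  define q where "q = p_param a d D"
  define s where "s = sqrt ((a * real d)\<^sup>2 + b\<^sup>2)"
  have q0: "q > 0" unfolding q_def by (rule p_param_pos[OF a D d])
  have q1: "q\<^sup>2 \<le> 1" using q0 p power_le_one[of q 2] by (simp add: q_def)
  have "cmod (poly (F_poly a d b) (of_real a * \<i>)) = lower_bound a d D * (s * q / (a * real d))"
    using d unfolding cmod_F_poly[OF a order_trans[OF one_le_numeral d]] lower_bound_times_p_param[OF a D d, symmetric] s_def q_def
    by (simp add: field_simps)
  also have "\<dots> = lower_bound a d D \<longleftrightarrow> s * q = a * real d"
    using lower_bound_pos[OF a D d] a d by (simp add: field_simps)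
  also have "\<dots> \<longleftrightarrow> (s * q)\<^sup>2 = (a * real d)\<^sup>2"
    using q0 a by (simp add: s_def power2_eq_iff_nonneg)
  also have "(s * q)\<^sup>2 = ((a * real d)\<^sup>2 + b\<^sup>2) * q\<^sup>2"
    by (simp add: s_def power_mult_distrib)
  also have "\<dots> = (a * real d)\<^sup>2 \<longleftrightarrow> b\<^sup>2 = (a * real d)\<^sup>2 * (1 - q\<^sup>2) / q\<^sup>2"
    using q0 by (auto simp: field_simps)
  also have "(a * real d)\<^sup>2 * (1 - q\<^sup>2) / q\<^sup>2 = (B_coeff a d D)\<^sup>2"
    unfolding B_coeff_eq[OF a D d] q_def[symmetric] using q1
    by (simp add: power_mult_distrib power_divide flip: power_mult)
  finally show ?thesis by (simp add: power2_eq_iff)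
qed

section \<open>The inequality and the shape of the extremal polynomials\<close>

text \<open>Sorting does not affect the discriminant, and a nonzero discriminant excludes repeated
  roots.\<close>

lemma K_sorted_roots:
  assumes f: "f \<in> K d D" and D: "D > 0"
  obtains y where "strict_mono_on {..<d} y" "f = (\<Prod>k<d. [:- y k, 1:])"
    "(\<Prod>(j, k) | j < k \<and> k < d. (y j - y k)\<^sup>2) = D"
proof -
  obtain x where x: "f = (\<Prod>k<d. [:- x k, 1:])" "(\<Prod>(j, k) | j < k \<and> k < d. (x j - x k)\<^sup>2) = D"
    using f unfolding in_K_iff by blast
  define xs where "xs = sort (map x [0..<d])"
  define y where "y k = xs ! k" for k
  have len: "length xs = d" by (simp add: xs_def)
  have prod_list: "prod_list (map (\<lambda>z. [:- z, 1:]) ys) = prod_mset (image_mset (\<lambda>z. [:- z, 1:]) (mset ys))"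
    for ys :: "real list" by (metis mset_map prod_mset_prod_list)
  have "f = prod_list (map (\<lambda>z. [:- z, 1:]) (map x [0..<d]))"
    unfolding x(1) by (simp add: prod.list_conv_set_nth atLeast0LessThan)
  also have "\<dots> = prod_mset (image_mset (\<lambda>z. [:- z, 1:]) (mset (map x [0..<d])))"
    by (rule prod_list)
  also have "mset (map x [0..<d]) = mset xs" by (simp add: xs_def)
  also have "prod_mset (image_mset (\<lambda>z. [:- z, 1:]) (mset xs)) = prod_list (map (\<lambda>z. [:- z, 1:]) xs)"
    by (rule prod_list[symmetric])
  also have "\<dots> = (\<Prod>k<d. [:- y k, 1:])"
    by (simp add: prod.list_conv_set_nth len y_def atLeast0LessThan)
  finally have y: "f = (\<Prod>k<d. [:- y k, 1:])" .
  have disc: "(\<Prod>(j, k) | j < k \<and> k < d. (y j - y k)\<^sup>2) = D"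
    using discriminant_eqI[OF x(1)] discriminant_eqI[OF y] x(2) by simp
  have "strict_mono_on {..<d} y"
  proof (rule strict_mono_onI)
    fix j k assume jk: "j \<in> {..<d}" "k \<in> {..<d}" "j < k"
    have "y j \<le> y k"
      unfolding y_def by (rule sorted_nth_mono) (use jk len in \<open>auto simp: xs_def\<close>)
    moreover have "y j \<noteq> y k"
    proof
      assume "y j = y k"
      then have "(\<Prod>(j, k) | j < k \<and> k < d. (y j - y k)\<^sup>2) = 0"
      proof (intro prod_zero bexI)
        show "finite {(j, k). j < k \<and> k < d}"
          by (rule finite_subset[of _ "{..<d} \<times> {..<d}"]) auto
        show "(j, k) \<in> {(j, k). j < k \<and> k < d}" using jk by simp
      qed (simp add: \<open>y j = y k\<close>)
      with disc D show False by simp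
    qed
    ultimately show "y j < y k" by simp
  qed
  with y disc that show ?thesis by blast
qed

lemma K_lower_bound:
  assumes a: "a > 0" and D: "D > 0" and d: "d \<ge> 2" and f: "f \<in> K d D"
  defines "M \<equiv> cmod (poly (map_poly complex_of_real f) (of_real a * \<i>))"
  shows "lower_bound a d D \<le> M"
    and "M = lower_bound a d D \<Longrightarrow> \<exists>b. map_poly complex_of_real f = F_poly a d b"
proof -
  obtain y where y: "strict_mono_on {..<d} y" "f = (\<Prod>k<d. [:- y k, 1:])"
    "(\<Prod>(j, k) | j < k \<and> k < d. (y j - y k)\<^sup>2) = D"
    using K_sorted_roots[OF f D] .
  \<comment> \<open>The arctangent preserves the order of the roots and puts all angles into (-pi/2,
    pi/2), so their spread is below pi and no cosine vanishes.\<close>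
  define \<alpha> where "\<alpha> k = arctan (y k / a)" for k
  define S where "S = (\<Prod>i<d. \<Prod>k\<in>{..<d} - {i}. \<bar>sin (\<alpha> i - \<alpha> k)\<bar>)"
  define Q where "Q = (real d / 2 ^ (d - 1)) ^ d"
  have yt: "y k = a * tan (\<alpha> k)" for k using a by (simp add: \<alpha>_def tan_arctan)
  have cos_ne: "cos (\<alpha> k) \<noteq> 0" for k by (simp add: \<alpha>_def)
  have mf: "map_poly complex_of_real f = (\<Prod>k<d. [:- complex_of_real (y k), 1:])"
    unfolding y(2) by (rule map_poly_of_real_prod)
  have M: "M = (\<Prod>k<d. cmod (of_real a * \<i> - of_real (y k)))"
    by (simp add: M_def mf poly_prod prod_norm)
  have "D * a ^ (d * (d - 1)) = M ^ (2 * (d - 1)) * S"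
    using discriminant_tan_roots[OF a, of d \<alpha>] cos_ne d y(3) unfolding M S_def yt by simp
  \<comment> \<open>Both sides equal D a^(d(d-1)). Since \<open>S\<close> is at most
    \<open>Q\<close>, \<open>M\<close> cannot be below the bound, and equality forces S = Q.\<close>
  then have rel: "lower_bound a d D ^ (2 * (d - 1)) * Q = M ^ (2 * (d - 1)) * S"
    unfolding lower_bound_power[OF a D d] Q_def .
  have mono: "strict_mono_on {..<d} \<alpha>"
    using y(1) a unfolding strict_mono_on_def \<alpha>_def by (auto simp: arctan_less_iff divide_strict_right_mono)
  have len: "\<alpha> (d - 1) < \<alpha> 0 + pi"
    using arctan_ubound[of "y (d - 1) / a"] arctan_lbound[of "y 0 / a"] by (simp add: \<alpha>_def)
  have SQ: "S \<le> Q" unfolding S_def Q_def by (rule prod_sin_diff_le_interval[OF mono len d])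
  have Q0: "Q > 0" using d by (simp add: Q_def)
  have M0: "M \<ge> 0" by (simp add: M_def)
  have "lower_bound a d D ^ (2 * (d - 1)) * Q \<le> M ^ (2 * (d - 1)) * Q"
    unfolding rel using SQ M0 by (intro mult_left_mono) auto
  then have "lower_bound a d D ^ (2 * (d - 1)) \<le> M ^ (2 * (d - 1))" using Q0 by simp
  then show "lower_bound a d D \<le> M"
    using M0 d power_le_imp_le_base[of "lower_bound a d D" "2 * (d - 1) - 1" M] by simp
  show "\<exists>b. map_poly complex_of_real f = F_poly a d b" if "M = lower_bound a d D"
  proof -
    have "S = Q" using rel lower_bound_pos[OF a D d] unfolding that by simp
    then have prog: "\<alpha> k = \<alpha> 0 + real k * pi / real d" if "k < d" for k
      using prod_sin_diff_le_interval(2)[OF mono len d] that unfolding S_def Q_def by blast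
    have "map_poly complex_of_real f
        = (\<Prod>k<d. [:- complex_of_real (a * tan (\<alpha> 0 + real k * pi / real d)), 1:])"
      unfolding mf yt by (intro prod.cong refl, subst prog) auto
    also have "\<dots> = F_poly a d (- 2 * a * real d
        * Im (cis (real d * \<alpha> 0) / (cis (real d * \<alpha> 0) - (- 1) ^ d * cnj (cis (real d * \<alpha> 0)))))"
    proof (rule prod_tan_roots_eq_F_poly[OF a])
      show "cos (\<alpha> 0 + real k * pi / real d) \<noteq> 0" if "k < d" for k
        unfolding prog[OF that, symmetric] by (rule cos_ne)
    qed (use d in simp)
    finally show ?thesis ..
  qed
qed

section \<open>The extremal polynomials and their roots\<close>

text \<open>If cos \<theta> = 0 then cis (2\<theta>) = -1. In its d-th power the shift k pi / d
  contributes only full turns, so the condition does not depend on \<open>k\<close>.\<close>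

lemma cos_arith_progression_nonzero:
  assumes d: "d \<ge> 1" and E: "cis (real d * \<beta>) ^ 2 \<noteq> (- 1) ^ d"
  shows "cos (\<beta> + real k * pi / real d) \<noteq> 0"
proof
  define \<theta> where "\<theta> = \<beta> + real k * pi / real d"
  assume "cos (\<beta> + real k * pi / real d) = 0"
  then have c0: "cos \<theta> = 0" by (simp add: \<theta>_def)
  have "cis (2 * \<theta>) = - 1"
    using c0 by (simp add: complex_eq_iff cos_double_cos sin_double)
  then have "(- 1) ^ d = cis (real d * (2 * \<theta>))" by (simp flip: Complex.DeMoivre)
  also have "real d * (2 * \<theta>) = real 2 * (real d * \<beta>) + 2 * pi * real k"
    using d by (simp add: \<theta>_def field_simps)
  also have "cis \<dots> = cis (real d * \<beta>) ^ 2 * cis (2 * pi * real k)"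
    by (simp only: cis_mult[symmetric] Complex.DeMoivre)
  also have "cis (2 * pi * real k) = 1" by (rule cis_multiple_2pi) auto
  finally show False using E by simp
qed

text \<open>With r = sqrt (1 - p^2), the number cis (d \<gamma>) is p + ir for odd \<open>d\<close>
  and r + ip for even \<open>d\<close>. Inserting it in \<open>prod_tan_roots_eq_F_poly\<close>
  gives the parameter B.\<close>

lemma F_poly_gamma:
  assumes a: "a > 0" and D: "D > 0" and d: "d \<ge> 2" and p: "p_param a d D \<le> 1"
  defines "\<gamma> \<equiv> gamma_angle a d D"
  shows "cos (\<gamma> + real k * pi / real d) \<noteq> 0"
    and "F_poly a d (B_coeff a d D) = (\<Prod>k<d. [:- complex_of_real (a * tan (\<gamma> + real k * pi / real d)), 1:])"
proof -
  define q where "q = p_param a d D"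
  define r where "r = sqrt (1 - q\<^sup>2)"
  define E where "E = cis (real d * \<gamma>)"
  have q: "0 < q" "q \<le> 1" using p_param_pos[OF a D d] p by (auto simp: q_def)
  have r2: "r * r = 1 - q * q"
    using q power_le_one[of q 2] by (simp add: r_def power2_eq_square)
  have E: "E = (if odd d then Complex q r else Complex r q)"
    using q d unfolding E_def \<gamma>_def gamma_angle_def q_def[symmetric] r_def
    by (simp add: complex_eq_iff sin_arccos cos_arcsin)
  \<comment> \<open>Equality would force q = 0 for either parity.\<close>
  have "E ^ 2 \<noteq> (- 1) ^ d"
    using q r2 by (cases "even d") (auto simp: E complex_eq_iff power2_eq_square)
  then show cos: "cos (\<gamma> + real k * pi / real d) \<noteq> 0" for k
    unfolding E_def using d by (intro cos_arith_progression_nonzero) auto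
  \<comment> \<open>The denominator is 2q for odd \<open>d\<close> and 2iq for even
    \<open>d\<close>. The resulting sign of r/(2q) accounts for the factor (-1)^d in
    \<open>B_coeff\<close>.\<close>
  have "- 2 * a * real d * Im (E / (E - (- 1) ^ d * cnj E)) = B_coeff a d D"
  proof (cases "even d")
    case True
    have "E / (E - (- 1) ^ d * cnj E) = Complex (1 / 2) (- r / (2 * q))"
      using True q by (simp add: E complex_eq_iff Re_divide Im_divide power2_eq_square)
    with True show ?thesis unfolding B_coeff_eq[OF a D d] by (simp add: r_def q_def)
  next
    case False
    have "E / (E - (- 1) ^ d * cnj E) = Complex (1 / 2) (r / (2 * q))"
      using False q by (simp add: E complex_eq_iff Re_divide Im_divide power2_eq_square)
    with False show ?thesis unfolding B_coeff_eq[OF a D d] by (simp add: r_def q_def)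
  qed
  moreover have "d \<ge> 1" using d by simp
  ultimately show "F_poly a d (B_coeff a d D) = (\<Prod>k<d. [:- complex_of_real (a * tan (\<gamma> + real k * pi / real d)), 1:])"
    using prod_tan_roots_eq_F_poly[OF a _ cos] unfolding E_def by (simp only:)
qed

lemma gamma_angle_range:
  assumes a: "a > 0" and D: "D > 0" and d: "d \<ge> 2" and p: "p_param a d D \<le> 1"
  shows "gamma_angle a d D \<in> {0..pi / (2 * real d)}"
proof -
  have "0 < p_param a d D" by (rule p_param_pos[OF a D d])
  with p have "0 \<le> arccos (p_param a d D)" "arccos (p_param a d D) \<le> pi / 2"
    "0 \<le> arcsin (p_param a d D)" "arcsin (p_param a d D) \<le> pi / 2"
    using arccos_lbound arccos_le_pi2 arcsin_nonneg arcsin_ubound by auto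
  then show ?thesis using d by (auto simp: gamma_angle_def divide_simps)
qed

text \<open>The discriminant is recovered backwards: the modulus at ai is the bound and the angles
  are equidistant, so \<open>discriminant_tan_roots\<close> and \<open>lower_bound_power\<close>
  have the same right-hand side. Reflection negates the roots, which keeps all squared
  differences.\<close>

lemma F_poly_in_K:
  assumes a: "a > 0" and D: "D > 0" and d: "d \<ge> 2" and p: "p_param a d D \<le> 1"
  shows "F_poly a d (B_coeff a d D) \<in> map_poly complex_of_real ` K d D"
    and "F_reflected a d (B_coeff a d D) \<in> map_poly complex_of_real ` K d D"
proof -
  define x where "x k = a * tan (gamma_angle a d D + real k * pi / real d)" for k
  have F: "F_poly a d (B_coeff a d D) = (\<Prod>k<d. [:- complex_of_real (x k), 1:])"
    unfolding x_def by (rule F_poly_gamma(2)[OF a D d p])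
  have "lower_bound a d D = cmod (poly (F_poly a d (B_coeff a d D)) (of_real a * \<i>))"
    by (rule sym) (simp add: cmod_F_poly_eq_lower_bound_iff[OF a D d p])
  also have "\<dots> = (\<Prod>k<d. cmod (of_real a * \<i> - of_real (x k)))"
    by (simp add: F poly_prod prod_norm)
  finally have LB: "lower_bound a d D = \<dots>" .
  have "(\<Prod>(j, k) | j < k \<and> k < d. (x j - x k)\<^sup>2) * a ^ (d * (d - 1)) = D * a ^ (d * (d - 1))"
  proof -
    have d1: "d \<ge> 1" using d by simp
    show ?thesis
      unfolding lower_bound_power[OF a D d] LB x_def
        prod_sin_diff_arith_progression[OF d1, of "gamma_angle a d D", symmetric]
      by (rule discriminant_tan_roots[OF a _ d1]) (rule F_poly_gamma(1)[OF a D d p])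
  qed
  then have disc: "(\<Prod>(j, k) | j < k \<and> k < d. (x j - x k)\<^sup>2) = D" using a by simp
  then have "(\<Prod>k<d. [:- x k, 1:]) \<in> K d D" unfolding in_K_iff by blast
  then show "F_poly a d (B_coeff a d D) \<in> map_poly complex_of_real ` K d D"
    unfolding F map_poly_of_real_prod[symmetric] by blast
  have "(\<Prod>(j, k) | j < k \<and> k < d. ((- x j) - (- x k))\<^sup>2) = D"
    using disc by (simp add: power2_commute)
  then have "(\<Prod>k<d. [:- (- x k), 1:]) \<in> K d D"
    unfolding in_K_iff by (intro exI[of _ "\<lambda>k. - x k"]) simp
  moreover have "F_reflected a d (B_coeff a d D) = map_poly complex_of_real (\<Prod>k<d. [:- (- x k), 1:])"
  proof -
    have "poly (F_reflected a d (B_coeff a d D)) z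
        = poly (map_poly complex_of_real (\<Prod>k<d. [:- (- x k), 1:])) z" for z
    proof -
      have "(- 1) ^ d * (\<Prod>k<d. - z - of_real (x k)) = (\<Prod>k<d. (- 1) * (- z - of_real (x k)))"
        by (simp only: prod.distrib) simp
      also have "\<dots> = (\<Prod>k<d. z + of_real (x k))" by (intro prod.cong) auto
      finally have "(- 1) ^ d * (\<Prod>k<d. - z - of_real (x k)) = (\<Prod>k<d. z + of_real (x k))" .
      then show ?thesis
        unfolding map_poly_of_real_prod F_reflected_def F
        by (simp add: poly_pcompose poly_prod algebra_simps)
    qed
    then show ?thesis by (simp add: fun_eq_iff flip: poly_eq_poly_eq_iff)
  qed
  ultimately show "F_reflected a d (B_coeff a d D) \<in> map_poly complex_of_real ` K d D"
    by blast
qed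

theorem theorem3:
  fixes a D :: real and d :: nat
  assumes "a > 0" and "D > 0" and "d \<ge> 2"
  shows "(\<forall>f \<in> K d D.
            cmod (poly (map_poly complex_of_real f) (of_real a * \<i>)) \<ge> lower_bound a d D) \<and>
         (a \<le> 2 powr (- 1 + 2 / real d) * real d powr (- 1 / (real d - 1))
                * D powr (1 / (real d * (real d - 1))) \<longrightarrow>
            F_poly a d (B_coeff a d D) \<in> map_poly complex_of_real ` K d D \<and>
            F_reflected a d (B_coeff a d D) \<in> map_poly complex_of_real ` K d D \<and>
            (\<forall>f \<in> K d D.
               cmod (poly (map_poly complex_of_real f) (of_real a * \<i>)) = lower_bound a d D \<longleftrightarrow>
               map_poly complex_of_real f = F_poly a d (B_coeff a d D) \<or>
               map_poly complex_of_real f = F_reflected a d (B_coeff a d D)) \<and>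
            p_param a d D \<le> 1 \<and>
            gamma_angle a d D \<in> {0 .. pi / (2 * real d)} \<and>
            {z. poly (F_poly a d (B_coeff a d D)) z = 0} =
              (\<lambda>k. complex_of_real (a * tan (gamma_angle a d D + real k * pi / real d)))
                ` {0..d - 1})"
proof (intro conjI impI ballI)
  fix f assume "f \<in> K d D"
  then show "cmod (poly (map_poly complex_of_real f) (of_real a * \<i>)) \<ge> lower_bound a d D"
    by (rule K_lower_bound(1)[OF assms])
next
  assume "a \<le> 2 powr (- 1 + 2 / real d) * real d powr (- 1 / (real d - 1))
                * D powr (1 / (real d * (real d - 1)))"
  then have p: "p_param a d D \<le> 1" by (rule p_param_le_one[OF assms])
  then show "p_param a d D \<le> 1" .
  show "gamma_angle a d D \<in> {0 .. pi / (2 * real d)}" by (rule gamma_angle_range[OF assms p])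
  show "F_poly a d (B_coeff a d D) \<in> map_poly complex_of_real ` K d D"
    and "F_reflected a d (B_coeff a d D) \<in> map_poly complex_of_real ` K d D"
    by (rule F_poly_in_K[OF assms p])+
  have "{0..d - 1} = {..<d}" using \<open>d \<ge> 2\<close> by auto
  then show "{z. poly (F_poly a d (B_coeff a d D)) z = 0} =
              (\<lambda>k. complex_of_real (a * tan (gamma_angle a d D + real k * pi / real d)))
                ` {0..d - 1}"
    unfolding F_poly_gamma(2)[OF assms p] poly_prod by (auto simp: prod_zero_iff)
  fix f assume f: "f \<in> K d D"
  show "cmod (poly (map_poly complex_of_real f) (of_real a * \<i>)) = lower_bound a d D \<longleftrightarrow>
               map_poly complex_of_real f = F_poly a d (B_coeff a d D) \<or>
               map_poly complex_of_real f = F_reflected a d (B_coeff a d D)"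
    (is "?M = _ \<longleftrightarrow> ?f = _ \<or> _")
  proof
    assume eq: "?M = lower_bound a d D"
    \<comment> \<open>Equality puts \<open>f\<close> into the family; the modulus then fixes
      \<open>b\<close> up to sign, and the negative sign is the reflected polynomial.\<close>
    then obtain b where b: "?f = F_poly a d b" using K_lower_bound(2)[OF assms f] by blast
    then have "b = B_coeff a d D \<or> b = - B_coeff a d D"
      using eq cmod_F_poly_eq_lower_bound_iff[OF assms p, of b] by simp
    then show "?f = F_poly a d (B_coeff a d D) \<or> ?f = F_reflected a d (B_coeff a d D)"
      unfolding b F_reflected_eq by blast
  next
    assume "?f = F_poly a d (B_coeff a d D) \<or> ?f = F_reflected a d (B_coeff a d D)"
    then obtain b where "?f = F_poly a d b" "b = B_coeff a d D \<or> b = - B_coeff a d D"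
      unfolding F_reflected_eq by blast
    then show "?M = lower_bound a d D"
      using cmod_F_poly_eq_lower_bound_iff[OF assms p, of b] by simp
  qed
qed

end
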